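(* Let $n$ and $m$ be positive integers with $n-1\leq m\leq \binom{n}{2}-1$, and let $k$ be the integer satisfying $\binom{k}{2}+(n-k)(k-1)< m\leq \binom{k}{2}+(n-k)k$. Then the minimum of $T(G)$ over all connected graphs $G$ with $n$ vertices and $m$ edges equals $\frac{k+1}{n-k}$.
   Context: All graphs are finite and simple. For a graph $G$, $\omega(G)$ denotes the number of components of $G$ and $\tau(G)$ the order (number of vertices) of a largest component of $G$. A vertex cut of $G$ is a set $X\subset V(G)$ with $\omega(G-X)>1$. The tenacity of a noncomplete connected graph $G$ is $T(G)=\min\left\{\frac{|X|+\tau(G-X)}{\omega(G-X)} : X\subset V(G),\ \omega(G-X)>1\right\}$. (For $n-1\le m\le\binom n2-1$ there is exactly one integer $k$ satisfying the stated inequalities, since the intervals $\left(\binom{k}{2}+(n-k)(k-1),\ \binom{k}{2}+(n-k)k\right]$ are consecutive.) *)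

theory Defs
  imports Complex_Main "HOL-Library.Infinite_Typeclass"
begin

record 'a ugraph =
  verts :: "'a set"
  edges :: "'a set set"

definition simple_graph :: "'a ugraph \<Rightarrow> bool" where
  "simple_graph G \<longleftrightarrow>
     finite (verts G) \<and> (\<forall>e\<in>edges G. e \<subseteq> verts G \<and> card e = 2)"

definition reachability :: "'a ugraph \<Rightarrow> ('a \<times> 'a) set" where
  "reachability G =
     {(u, v). u \<in> verts G \<and> v \<in> verts G \<and> (u, v) \<in> {(x, y). {x, y} \<in> edges G}\<^sup>*}"

definition connected_graph :: "'a ugraph \<Rightarrow> bool" where
  "connected_graph G \<longleftrightarrow>
     verts G \<noteq> {} \<and> (\<forall>u\<in>verts G. \<forall>v\<in>verts G. (u, v) \<in> reachability G)"

text \<open>A component is represented by its vertex set.\<close>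

definition components :: "'a ugraph \<Rightarrow> 'a set set" where
  "components G = verts G // reachability G"

definition num_components :: "'a ugraph \<Rightarrow> nat" where
  "num_components G = card (components G)"

definition max_component_order :: "'a ugraph \<Rightarrow> nat" where
  "max_component_order G = Max (card ` components G)"

definition delete_verts :: "'a ugraph \<Rightarrow> 'a set \<Rightarrow> 'a ugraph" where
  "delete_verts G X =
     \<lparr>verts = verts G - X, edges = {e \<in> edges G. e \<inter> X = {}}\<rparr>"

definition vertex_cut :: "'a ugraph \<Rightarrow> 'a set \<Rightarrow> bool" where
  "vertex_cut G X \<longleftrightarrow> X \<subset> verts G \<and> num_components (delete_verts G X) > 1"

text \<open>
  Meaningful for noncomplete connected graphs only: a complete graph has no vertex cut,
  so the minimum would range over the empty set.
\<close>

definition tenacity :: "'a ugraph \<Rightarrow> real" where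
  "tenacity G =
     Min {real (card X + max_component_order (delete_verts G X))
            / real (num_components (delete_verts G X)) | X. vertex_cut G X}"

text \<open>
  The vertex type is required to be infinite where this is used, so that every finite
  graph has an isomorphic copy over it.
\<close>

definition connected_graphs :: "nat \<Rightarrow> nat \<Rightarrow> 'a ugraph set" where
  "connected_graphs n m =
     {G. simple_graph G \<and> connected_graph G \<and> card (verts G) = n \<and> card (edges G) = m}"

definition is_minimum_of :: "real \<Rightarrow> real set \<Rightarrow> bool" where
  "is_minimum_of x S \<longleftrightarrow> x \<in> S \<and> (\<forall>y\<in>S. x \<le> y)"

end

theory Submission
  imports Defs
begin

text \<open>
  The bounds on \<open>m\<close> say that \<open>G\<close> has fewer than \<open>n - k + 1 choose 2\<close> non-edges.
  Let \<open>X\<close> be a vertex cut. Representatives of the components of \<open>G - X\<close> are pairwise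
  non-adjacent, so \<open>G - X\<close> has at most \<open>n - k\<close> components. Moreover every vertex of \<open>G - X\<close> is
  non-adjacent to at least \<open>n - |X| - \<tau>\<close> others; if \<open>|X| + \<tau> \<le> k\<close>, summing this over
  the at least \<open>n - k + 1\<close> vertices of \<open>G - X\<close> would give too many non-edges. Hence
  \<open>|X| + \<tau> \<ge> k + 1\<close>. Equality holds for a graph with \<open>m\<close> edges that contains a spanning star
  centred in a \<open>k\<close>-set \<open>A\<close> and all of whose edges meet \<open>A\<close>, by deleting \<open>A\<close>.
\<close>

section \<open>The complement graph, and components as equivalence classes\<close>

definition non_edges :: "'a ugraph \<Rightarrow> 'a set set" where
  "non_edges G = {e. e \<subseteq> verts G \<and> card e = 2} - edges G"

text \<open>Turns the bounds on \<open>m\<close> into bounds on the number of non-edges, the form in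
  which the lower bound uses them.\<close>

lemma card_non_edges:
  assumes "simple_graph G"
  shows "card (non_edges G) + card (edges G) = card (verts G) choose 2"
proof -
  let ?P = "{e. e \<subseteq> verts G \<and> card e = 2}"
  have fin: "finite (verts G)" and sub: "edges G \<subseteq> ?P"
    using assms by (auto simp: simple_graph_def)
  have finP: "finite ?P" using fin by simp
  have "card ?P = card (verts G) choose 2" using fin by (rule n_subsets)
  moreover have "card (non_edges G) = card ?P - card (edges G)"
    unfolding non_edges_def using sub finP by (simp add: card_Diff_subset finite_subset)
  moreover have "card (edges G) \<le> card ?P" using sub finP by (rule card_mono[rotated])
  ultimately show ?thesis by simp
qed

lemma finite_non_edges: "simple_graph G \<Longrightarrow> finite (non_edges G)"
  by (simp add: non_edges_def simple_graph_def)

lemma simple_graph_delete_verts: "simple_graph G \<Longrightarrow> simple_graph (delete_verts G X)"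
  by (auto simp: simple_graph_def delete_verts_def)

lemma non_edges_delete_verts: "non_edges (delete_verts G X) \<subseteq> non_edges G"
  by (auto simp: non_edges_def delete_verts_def)

lemma equiv_reachability: "equiv (verts G) (reachability G)"
proof (rule equivI)
  show "reachability G \<subseteq> verts G \<times> verts G" by (auto simp: reachability_def)
  show "refl_on (verts G) (reachability G)" by (auto simp: reachability_def refl_on_def)
  have "sym {(x, y). {x, y} \<in> edges G}" by (auto simp: sym_def insert_commute)
  then have "sym ({(x, y). {x, y} \<in> edges G}\<^sup>*)" by (rule sym_rtrancl)
  then show "sym (reachability G)" by (auto simp: reachability_def sym_def)
  show "trans (reachability G)" by (auto simp: reachability_def trans_def)
qed

text \<open>An edge is a path of length one, and the empty path joins a vertex to itself. Both
  counts of non-edges below rest on this.\<close>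

lemma non_edge_if_not_reachable:
  assumes "u \<in> verts G" "v \<in> verts G" "(u, v) \<notin> reachability G"
  shows "u \<noteq> v" "{u, v} \<in> non_edges G"
  using assms by (auto simp: reachability_def non_edges_def card_insert_if)

lemma finite_components: "simple_graph G \<Longrightarrow> finite (components G)"
  unfolding components_def simple_graph_def
  by (intro finite_quotient equiv_type[OF equiv_reachability]) simp

section \<open>Lower bounds on the number of non-edges\<close>

lemma num_components_choose_le:
  assumes "simple_graph G"
  shows "num_components G choose 2 \<le> card (non_edges G)"
proof -
  define rep where "rep C = (SOME v. v \<in> C)" for C :: "'a set"
  let ?R = "rep ` components G"
  have rep: "rep C \<in> C" "C \<subseteq> verts G" if "C \<in> components G" for C
  proof -
    have "C \<noteq> {}" "C \<subseteq> verts G" using that equiv_reachability[of G]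
      unfolding components_def by (auto dest: in_quotient_imp_non_empty in_quotient_imp_subset)
    then show "rep C \<in> C" "C \<subseteq> verts G" unfolding rep_def by (auto intro: someI)
  qed
  have same: "C = D" if "C \<in> components G" "D \<in> components G"
    "(rep C, rep D) \<in> reachability G" for C D
    using that rep quotient_eq_iff[OF equiv_reachability[of G]] unfolding components_def by blast
  have refl: "(v, v) \<in> reachability G" if "v \<in> verts G" for v
    using that by (simp add: reachability_def)
  \<comment> \<open>By \<open>same\<close> and reflexivity, distinct components have distinct
    representatives, so the left-hand side counts pairs of representatives.\<close>
  have "inj_on rep (components G)"
    by (rule inj_onI) (metis same refl rep subsetD)
  then have "card ?R = num_components G" by (simp add: card_image num_components_def)
  moreover have "finite ?R" using finite_components[OF assms] by simp
  ultimately have "num_components G choose 2 = card {e. e \<subseteq> ?R \<and> card e = 2}"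
    using n_subsets[of ?R 2] by simp
  also have "\<dots> \<le> card (non_edges G)"
  proof (rule card_mono[OF finite_non_edges[OF assms]], rule subsetI)
    fix e assume "e \<in> {e. e \<subseteq> ?R \<and> card e = 2}"
    then obtain u v where "e = {u, v}" "u \<noteq> v" "u \<in> ?R" "v \<in> ?R"
      by (auto simp: card_2_iff)
    then obtain C D where "e = {rep C, rep D}" "C \<in> components G" "D \<in> components G" "C \<noteq> D"
      by blast
    then show "e \<in> non_edges G"
      using same rep by (metis non_edge_if_not_reachable(2) subsetD)
  qed
  finally show ?thesis .
qed

lemma card_component_le:
  assumes "simple_graph G" "C \<in> components G"
  shows "card C \<le> max_component_order G"
  using assms finite_components[of G] by (simp add: max_component_order_def)

text \<open>Double counting of ordered pairs in different components: for each first vertex only its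
  own component, of order at most \<tau>, is excluded as second vertex, while each non-edge accounts
  for at most two ordered pairs.\<close>

lemma order_times_codegree_le:
  assumes "simple_graph G"
  shows "card (verts G) * (card (verts G) - max_component_order G) \<le> 2 * card (non_edges G)"
proof -
  let ?V = "verts G"
  let ?S = "SIGMA u:?V. ?V - reachability G `` {u}"
  have fin: "finite ?V" using assms by (simp add: simple_graph_def)
  have "card ?V - max_component_order G \<le> card (?V - reachability G `` {u})" if "u \<in> ?V" for u
  proof -
    have "reachability G `` {u} \<in> components G"
      using that unfolding components_def by (rule quotientI)
    then have "card (reachability G `` {u}) \<le> max_component_order G"
      by (rule card_component_le[OF assms])
    moreover have "card ?V - card (reachability G `` {u}) \<le> card (?V - reachability G `` {u})"
      by (rule diff_card_le_card_Diff) (auto simp: reachability_def intro: finite_subset[OF _ fin])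
    ultimately show ?thesis by simp
  qed
  then have "card ?V * (card ?V - max_component_order G)
      \<le> (\<Sum>u\<in>?V. card (?V - reachability G `` {u}))"
    using sum_bounded_below[of ?V "card ?V - max_component_order G"
        "\<lambda>u. card (?V - reachability G `` {u})"] by simp
  also have "\<dots> = card ?S" using fin by simp
  \<comment> \<open>Sorts the ordered pairs by the non-edge they span, which allows a bound on each
    fibre separately.\<close>
  also have "\<dots> \<le> card (\<Union>e\<in>non_edges G. {(u, v). u \<noteq> v \<and> {u, v} = e})"
  proof (rule card_mono)
    have "(\<Union>e\<in>non_edges G. {(u, v). u \<noteq> v \<and> {u, v} = e}) \<subseteq> ?V \<times> ?V"
      by (auto simp: non_edges_def)
    then show "finite (\<Union>e\<in>non_edges G. {(u, v). u \<noteq> v \<and> {u, v} = e})"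
      using fin by (meson finite_SigmaI finite_subset)
    show "?S \<subseteq> (\<Union>e\<in>non_edges G. {(u, v). u \<noteq> v \<and> {u, v} = e})"
    proof (rule subsetI)
      fix z assume "z \<in> ?S"
      then obtain u v where "z = (u, v)" "u \<in> ?V" "v \<in> ?V" "(u, v) \<notin> reachability G" by auto
      then show "z \<in> (\<Union>e\<in>non_edges G. {(u, v). u \<noteq> v \<and> {u, v} = e})"
        using non_edge_if_not_reachable[of u G v] by simp
    qed
  qed
  also have "\<dots> \<le> (\<Sum>e\<in>non_edges G. card {(u, v). u \<noteq> v \<and> {u, v} = e})"
    by (rule card_UN_le[OF finite_non_edges[OF assms]])
  also have "\<dots> \<le> (\<Sum>e\<in>non_edges G. 2)"
  proof (rule sum_mono)
    fix e assume "e \<in> non_edges G"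
    then obtain a b where e: "e = {a, b}" by (auto simp: non_edges_def card_2_iff)
    have "{(u, v). u \<noteq> v \<and> {u, v} = e} \<subseteq> {(a, b), (b, a)}"
      unfolding e by (auto simp: doubleton_eq_iff)
    then have "card {(u, v). u \<noteq> v \<and> {u, v} = e} \<le> card {(a, b), (b, a)}"
      by (rule card_mono[rotated]) simp
    also have "\<dots> \<le> 2" by (rule card_insert_le_m1) simp_all
    finally show "card {(u, v). u \<noteq> v \<and> {u, v} = e} \<le> 2" .
  qed
  finally show ?thesis by simp
qed

section \<open>Lower bound on the tenacity\<close>

lemma max_component_order_pos:
  assumes "simple_graph G" "num_components G > 0"
  shows "max_component_order G > 0"
proof -
  obtain C where C: "C \<in> components G"
    using assms(2) by (fastforce simp: num_components_def card_gt_0_iff)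
  then have "C \<noteq> {}" "C \<subseteq> verts G" using equiv_reachability[of G]
    unfolding components_def by (auto dest: in_quotient_imp_non_empty in_quotient_imp_subset)
  then have "card C > 0"
    using assms(1) by (auto simp: simple_graph_def card_gt_0_iff intro: finite_subset)
  then show ?thesis using card_component_le[OF assms(1) C] by simp
qed

text \<open>Numerator and denominator are bounded separately, by k + 1 from below and by n - k from
  above; the failure of either bound would produce more non-edges than \<open>few\<close>
  allows.\<close>

lemma vertex_cut_ratio_ge:
  assumes G: "simple_graph G" and k: "k < card (verts G)"
    and few: "card (non_edges G) < (card (verts G) - k + 1) choose 2"
    and cut: "vertex_cut G X"
  shows "(real k + 1) / (real (card (verts G)) - real k)
    \<le> real (card X + max_component_order (delete_verts G X))
        / real (num_components (delete_verts G X))"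
proof -
  define H where "H = delete_verts G X"
  define p where "p = card (verts G) - k"
  let ?w = "num_components H" and ?t = "max_component_order H"
  have H: "simple_graph H" unfolding H_def by (rule simple_graph_delete_verts[OF G])
  have w: "?w > 1" and X: "X \<subseteq> verts G" using cut by (auto simp: vertex_cut_def H_def)
  have finX: "finite X" using X G by (auto simp: simple_graph_def intro: finite_subset)
  have nH: "card (verts H) + card X = card (verts G)"
    using X finX G card_mono[of "verts G" X]
    by (simp add: H_def delete_verts_def card_Diff_subset simple_graph_def)
  have "card (non_edges H) \<le> card (non_edges G)"
    unfolding H_def by (rule card_mono[OF finite_non_edges[OF G] non_edges_delete_verts])
  then have few': "card (non_edges H) < (p + 1) choose 2" using few by (simp add: p_def)
  have "?w \<le> p"
  proof (rule ccontr)
    assume "\<not> ?w \<le> p"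
    then have "(p + 1) choose 2 \<le> ?w choose 2" by (intro binomial_right_mono) simp
    then show False using num_components_choose_le[OF H] few' by simp
  qed
  moreover have "k + 1 \<le> card X + ?t"
  proof (rule ccontr)
    assume "\<not> k + 1 \<le> card X + ?t"
    \<comment> \<open>Since \<tau> \<ge> 1, the assumption |X| + \<tau> \<le> k gives |X| \<le> k -
      1. This extra unit leaves p + 1 vertices in \<open>H\<close> rather than p, and (p + 1) p is
      exactly twice the bound in \<open>few'\<close>.\<close>
    moreover have "?t > 0" using max_component_order_pos[OF H] w by simp
    ultimately have "p + 1 \<le> card (verts H)" "p \<le> card (verts H) - ?t"
      using nH k by (auto simp: p_def)
    then have "(p + 1) * p \<le> card (verts H) * (card (verts H) - ?t)" by (rule mult_le_mono)
    also have "\<dots> \<le> 2 * card (non_edges H)" by (rule order_times_codegree_le[OF H])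
    finally show False using few' by (simp add: choose_two)
  qed
  ultimately have "(real k + 1) / real p \<le> real (card X + ?t) / real ?w"
    using w by (intro frac_le) auto
  then show ?thesis using k by (simp add: p_def H_def of_nat_diff)
qed

lemma components_edgeless:
  assumes "edges G = {}"
  shows "components G = (\<lambda>v. {v}) ` verts G"
proof -
  have "reachability G = Id_on (verts G)" using assms by (auto simp: reachability_def)
  then show ?thesis by (auto simp: components_def quotient_def)
qed

text \<open>Deleting all but two non-adjacent vertices leaves two isolated ones. This keeps the
  \<open>Min\<close> in \<open>tenacity\<close> from being taken over the empty set.\<close>

lemma vertex_cut_exists:
  assumes G: "simple_graph G" and "non_edges G \<noteq> {}"
  shows "\<exists>X. vertex_cut G X"
proof -
  obtain u v where uv: "u \<noteq> v" "u \<in> verts G" "v \<in> verts G" "{u, v} \<notin> edges G"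
    using assms(2) by (auto simp: non_edges_def card_2_iff)
  define H where "H = delete_verts G (verts G - {u, v})"
  have H: "simple_graph H" unfolding H_def by (rule simple_graph_delete_verts[OF G])
  have VH: "verts H = {u, v}" using uv by (auto simp: H_def delete_verts_def)
  have EH: "edges H = {}"
  proof (rule equals0I)
    fix e assume "e \<in> edges H"
    then have "e \<in> edges G" "e \<subseteq> {u, v}" "card e = 2"
      using H VH by (auto simp: simple_graph_def H_def delete_verts_def)
    moreover from this(2,3) have "e = {u, v}" using uv(1) by (intro card_subset_eq) auto
    ultimately show False using uv(4) by simp
  qed
  then have "components H = {{u}, {v}}" using VH by (simp add: components_edgeless)
  then have "num_components H > 1" using uv(1) by (simp add: num_components_def)
  moreover have "verts G - {u, v} \<subset> verts G" using uv(2) by blast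
  ultimately show ?thesis unfolding vertex_cut_def H_def by blast
qed

lemma finite_tenacity_ratios:
  assumes "simple_graph G"
  shows "finite {real (card X + max_component_order (delete_verts G X))
            / real (num_components (delete_verts G X)) | X. vertex_cut G X}"
proof -
  have "{X. vertex_cut G X} \<subseteq> Pow (verts G)" by (auto simp: vertex_cut_def)
  then have "finite {X. vertex_cut G X}"
    using assms by (auto simp: simple_graph_def intro: finite_subset)
  then show ?thesis by (simp add: setcompr_eq_image)
qed

lemma tenacity_ge:
  assumes "simple_graph G" "k < card (verts G)" "non_edges G \<noteq> {}"
    and "card (non_edges G) < (card (verts G) - k + 1) choose 2"
  shows "(real k + 1) / (real (card (verts G)) - real k) \<le> tenacity G"
  unfolding tenacity_def
proof (rule Min.boundedI[OF finite_tenacity_ratios[OF assms(1)]])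
  show "{real (card X + max_component_order (delete_verts G X))
            / real (num_components (delete_verts G X)) | X. vertex_cut G X} \<noteq> {}"
    using vertex_cut_exists[OF assms(1,3)] by blast
qed (use vertex_cut_ratio_ge[OF assms(1,2,4)] in blast)

section \<open>Upper bound and extremal graph\<close>

lemma tenacity_le:
  assumes "simple_graph G" "vertex_cut G X"
  shows "tenacity G \<le> real (card X + max_component_order (delete_verts G X))
            / real (num_components (delete_verts G X))"
  unfolding tenacity_def
  using assms by (intro Min_le finite_tenacity_ratios) blast+

text \<open>The last hypothesis says that at least m pairs meet a fixed k-subset of n vertices, so m
  edges can be chosen between a spanning star and the set of all those pairs. The star ensures
  connectedness; meeting \<open>A\<close> ensures that deleting \<open>A\<close> leaves no
  edge.\<close>

lemma star_extension_exists:
  assumes "0 < k" "k < n" "n - 1 \<le> m" "m + ((n - k) choose 2) \<le> n choose 2"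
  shows "\<exists>(G :: 'a::infinite ugraph) \<in> connected_graphs n m.
    \<exists>A \<subseteq> verts G. card A = k \<and> (\<forall>e\<in>edges G. e \<inter> A \<noteq> {})"
proof -
  obtain V :: "'a set" where V: "finite V" "card V = n"
    using infinite_arbitrarily_large[OF infinite_UNIV] by blast
  obtain A where A: "A \<subseteq> V" "card A = k"
    using obtain_subset_with_card_n[of k V] V(2) assms(2) by auto
  obtain a where a: "a \<in> A" using A(2) assms(1) by fastforce
  have finA: "finite A" using A V by (auto intro: finite_subset)
  let ?S = "(\<lambda>v. {a, v}) ` (V - {a})"
  let ?P = "{e. e \<subseteq> V \<and> card e = 2}"
  \<comment> \<open>These pairs avoid \<open>A\<close>, so \<open>?P - ?Q\<close> consists of the
    pairs that meet \<open>A\<close>; the star edges lie there because the centre \<open>a\<close>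
    is in \<open>A\<close>.\<close>
  let ?Q = "{e. e \<subseteq> V - A \<and> card e = 2}"
  have "inj_on (\<lambda>v. {a, v}) (V - {a})" by (auto simp: inj_on_def doubleton_eq_iff)
  then have cardS: "card ?S = n - 1" using V A a by (subst card_image) auto
  have "card (V - A) = n - k" using A V finA by (simp add: card_Diff_subset)
  then have "card ?P = n choose 2" "card ?Q = (n - k) choose 2"
    using n_subsets[of V 2] n_subsets[of "V - A" 2] V by auto
  moreover have "?Q \<subseteq> ?P" by auto
  ultimately have cardPQ: "card (?P - ?Q) = (n choose 2) - ((n - k) choose 2)"
    using V by (simp add: card_Diff_subset)
  have sub: "?S \<subseteq> ?P - ?Q" using A a by auto
  have bounds: "card ?S \<le> m" "m \<le> card (?P - ?Q)" "finite (?P - ?Q)"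
    unfolding cardS cardPQ using assms V(1) by simp_all
  obtain E where E: "?S \<subseteq> E" "E \<subseteq> ?P - ?Q" "card E = m"
    using exists_subset_between[OF bounds(1,2) sub bounds(3)] by (elim exE conjE)
  define G where "G = \<lparr>verts = V, edges = E\<rparr>"
  have G: "verts G = V" "edges G = E" by (simp_all add: G_def)
  have "simple_graph G" using V E by (auto simp: simple_graph_def G)
  moreover have "connected_graph G"
  proof -
    have av: "(a, v) \<in> reachability G" if "v \<in> V" for v
    proof (cases "v = a")
      case False
      then have "{a, v} \<in> E" using E(1) that by blast
      then show ?thesis using that a A by (auto simp: reachability_def G)
    qed (use that in \<open>auto simp: reachability_def G\<close>)
    have "(u, v) \<in> reachability G" if "u \<in> V" "v \<in> V" for u v
      using av that equiv_reachability[of G] by (meson equivE symD transD)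
    then show ?thesis using a A by (auto simp: connected_graph_def G)
  qed
  ultimately have "G \<in> connected_graphs n m" using V E by (simp add: connected_graphs_def G)
  moreover have "\<forall>e\<in>edges G. e \<inter> A \<noteq> {}" using E(2) by (auto simp: G)
  ultimately show ?thesis using A by (metis G(1))
qed

section \<open>Arithmetic of the bounds on m, and conclusion\<close>

theorem theorem1:
  fixes n m :: nat and k :: int
  assumes "n > 0" and "m > 0"
    and "int n - 1 \<le> int m" and "int m \<le> int (n choose 2) - 1"
    and "(real_of_int k gchoose 2) + (real n - real_of_int k) * (real_of_int k - 1) < real m"
    and "real m \<le> (real_of_int k gchoose 2) + (real n - real_of_int k) * real_of_int k"
  shows "is_minimum_of ((real_of_int k + 1) / (real n - real_of_int k))
           (tenacity ` (connected_graphs n m :: 'a::infinite ugraph set))"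
proof -
  \<comment> \<open>The sign of \<open>k\<close> is still open, so its binomial coefficient is
    treated as a polynomial; doubling then clears the fraction and permits integer
    arithmetic.\<close>
  have g2: "(x gchoose 2) = x * (x - 1) / 2" for x :: real
    by (simp add: gbinomial_prod_rev numeral_2_eq_2)
  have c2: "2 * int (q choose 2) = int q * (int q - 1)" for q :: nat
  proof -
    have "2 * (q choose 2) = q * (q - 1)"
      unfolding choose_two by (intro dvd_mult_div_cancel) (cases q; simp)
    then have "2 * int (q choose 2) = int (q * (q - 1))" by linarith
    then show ?thesis by (cases q) (simp_all add: algebra_simps)
  qed
  have lo: "2 * int n * (k - 1) - k * (k - 1) < 2 * int m"
  proof -
    have "real_of_int (2 * int n * (k - 1) - k * (k - 1)) < real_of_int (2 * int m)"
      using assms(5) by (simp add: g2 field_simps)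
    then show ?thesis by (simp only: of_int_less_iff)
  qed
  have hi: "2 * int m \<le> 2 * int n * k - k * (k + 1)"
  proof -
    have "real_of_int (2 * int m) \<le> real_of_int (2 * int n * k - k * (k + 1))"
      using assms(6) by (simp add: g2 field_simps)
    then show ?thesis by (simp only: of_int_le_iff)
  qed
  \<comment> \<open>Chaining \<open>lo\<close> and \<open>hi\<close> cancels the quadratic terms and
    leaves 2 k < 2 n.\<close>
  have kn: "k < int n" using lo hi by (simp add: algebra_simps)
  have k0: "0 < k"
  proof (rule ccontr)
    assume "\<not> 0 < k"
    \<comment> \<open>The product is the right-hand side of \<open>hi\<close>; if it is nonpositive,
      then m = 0.\<close>
    then have "k * (2 * int n - (k + 1)) \<le> 0" using assms(1) by (intro mult_nonpos_nonneg) auto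
    then show False using hi assms(2) by (simp add: algebra_simps)
  qed
  define q where "q = nat k"
  have q: "k = int q" "0 < q" "q < n" using k0 kn by (auto simp: q_def)
  have nq: "int (n - q) = int n - k" "int (n - q + 1) = int n - k + 1" using q by auto
  \<comment> \<open>The threshold C(k,2) + (n-k)(k-1) equals C(n,2) - C(n-k+1,2). Likewise, for
    \<open>room\<close>, C(k,2) + (n-k)k equals C(n,2) - C(n-k,2).\<close>
  have few: "n choose 2 < m + ((n - q + 1) choose 2)"
    using lo c2[of n] c2[of "n - q + 1"] unfolding nq by (simp add: algebra_simps)
  have room: "m + ((n - q) choose 2) \<le> n choose 2"
    using hi c2[of n] c2[of "n - q"] unfolding nq by (simp add: algebra_simps)
  have m: "n - 1 \<le> m" "m < n choose 2" using assms(3,4) by auto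
  have lower: "(real q + 1) / (real n - real q) \<le> tenacity G"
    if "G \<in> connected_graphs n m" for G :: "'a ugraph"
  proof -
    have G: "simple_graph G" "card (verts G) = n" "card (edges G) = m"
      using that by (auto simp: connected_graphs_def)
    then have "card (non_edges G) + m = n choose 2" using card_non_edges[OF G(1)] by simp
    \<comment> \<open>As m < C(n,2), some non-edge exists, which \<open>tenacity_ge\<close>
      requires.\<close>
    then show ?thesis using tenacity_ge[OF G(1), of q] G q m few by fastforce
  qed
  obtain G :: "'a ugraph" and A where G: "G \<in> connected_graphs n m"
    and A: "A \<subseteq> verts G" "card A = q" "\<forall>e\<in>edges G. e \<inter> A \<noteq> {}"
    using star_extension_exists[OF q(2,3) m(1) room] by blast
  have sG: "simple_graph G" "finite (verts G)" "card (verts G) = n"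
    using G by (auto simp: connected_graphs_def simple_graph_def)
  let ?H = "delete_verts G A"
  have "edges ?H = {}" using A(3) by (auto simp: delete_verts_def)
  then have comps: "components ?H = (\<lambda>v. {v}) ` (verts G - A)"
    by (simp add: components_edgeless) (simp add: delete_verts_def)
  have cVA: "card (verts G - A) = n - q"
    using A sG by (simp add: card_Diff_subset finite_subset)
  have w: "num_components ?H = n - q"
    unfolding num_components_def comps using cVA by (simp add: card_image)
  have ne: "verts G - A \<noteq> {}" using cVA q by force
  then have t: "max_component_order ?H = 1"
    unfolding max_component_order_def comps image_image by (simp add: image_constant_conv)
  \<comment> \<open>A single remaining vertex would not make \<open>A\<close> a cut. In that case
    \<open>few\<close> would force m \<ge> C(n,2), so that G would be complete.\<close>
  have "n - q \<noteq> 1"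
  proof
    assume "n - q = 1"
    then have "n choose 2 < m + 1" using few by (simp add: choose_two)
    then show False using m by simp
  qed
  then have "vertex_cut G A" using w q A ne by (auto simp: vertex_cut_def)
  from tenacity_le[OF sG(1) this] have "tenacity G \<le> (real q + 1) / (real n - real q)"
    using w t A q by (simp add: of_nat_diff add.commute)
  with lower[OF G] have "tenacity G = (real q + 1) / (real n - real q)" by simp
  then show ?thesis using lower G unfolding is_minimum_of_def q(1) by force
qed

end
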